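(* Let $\Omega\subset\mathbb{C}^n$ be an open set and let $K=k_1+\sqrt{-1}\,k_2:\Omega\to\mathbb{C}$ be a complex-valued structural function, with $k_1,k_2$ real-valued, continuous and differentiable in the real coordinates. Then the generalized exterior differential operator $\mathcal{D}$ associated with $K$, acting on (differentiable) complex-valued functions $w$ on $\Omega$, is $$\mathcal{D}=d+dK=\mathrm{D}+\overline{\mathrm{D}},$$ where $\mathrm{D}=\partial+\partial K$, $\overline{\mathrm{D}}=\overline{\partial}+\overline{\partial}K$ and $d=\partial+\overline{\partial}$. That is, $\mathcal{D}w=dw+w\,dK=(\partial w+w\,\partial K)+(\overline{\partial}w+w\,\overline{\partial}K)$ for every such $w$.
   Context: Coordinates on $\mathbb{C}^n$ are $z^i=x^i+\sqrt{-1}\,y^i$, $i=1,\dots,n$, with Wirtinger derivatives $\frac{\partial}{\partial z^i}=\frac12\left(\frac{\partial}{\partial x^i}-\sqrt{-1}\frac{\partial}{\partial y^i}\right)$ and $\frac{\partial}{\partial\overline{z^i}}=\frac12\left(\frac{\partial}{\partial x^i}+\sqrt{-1}\frac{\partial}{\partial y^i}\right)$. Repeated indices are summed from $1$ to $n$. For a function $f$, $\partial f=\frac{\partial f}{\partial z^i}dz^i$, $\overline{\partial}f=\frac{\partial f}{\partial\overline{z^i}}d\overline{z^i}$, $df=\partial f+\overline{\partial}f$. The generalized Wirtinger derivatives associated with $K$ are $\frac{\mathrm{D}}{\partial z^i}=\frac{\partial}{\partial z^i}+\frac{\partial K}{\partial z^i}$ and $\frac{\mathrm{D}}{\partial\overline{z^i}}=\frac{\partial}{\partial\overline{z^i}}+\frac{\partial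 K}{\partial\overline{z^i}}$, where the derivatives of $K$ act by multiplication: $\frac{\mathrm{D}w}{\partial z^i}=\frac{\partial w}{\partial z^i}+w\frac{\partial K}{\partial z^i}$, and similarly for $\overline{z^i}$. The generalized exterior differential of a complex-valued function $w$ is defined by $\mathcal{D}w=\frac{\mathrm{D}w}{\partial z^i}dz^i+\frac{\mathrm{D}w}{\partial\overline{z^i}}d\overline{z^i}$. In the operators $d+dK$, $\partial+\partial K$, $\overline{\partial}+\overline{\partial}K$, the forms $dK,\partial K,\overline{\partial}K$ act on $w$ by multiplication. *)

theory Defs
  imports "HOL-Analysis.Analysis"
begin

text \<open>
  The space \<open>complex ^ 'n\<close> is viewed as a real vector space with coordinates
  \<open>x\<^sup>i = Re (z $ i)\<close> and \<open>y\<^sup>i = Im (z $ i)\<close>.  In particular, differentiability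
  (\<^const>\<open>differentiable\<close>, \<^const>\<open>frechet_derivative\<close>) always means real differentiability.
  A complex-valued 1-form sends a point and a tangent vector to a complex number.
\<close>

type_synonym 'n cform = "complex ^ 'n \<Rightarrow> complex ^ 'n \<Rightarrow> complex"

definition partial_x :: "'n::finite \<Rightarrow> (complex ^ 'n \<Rightarrow> complex) \<Rightarrow> complex ^ 'n \<Rightarrow> complex" where
  "partial_x i f z = vector_derivative (\<lambda>t::real. f (z + t *\<^sub>R axis i 1)) (at 0)"

definition partial_y :: "'n::finite \<Rightarrow> (complex ^ 'n \<Rightarrow> complex) \<Rightarrow> complex ^ 'n \<Rightarrow> complex" where
  "partial_y i f z = vector_derivative (\<lambda>t::real. f (z + t *\<^sub>R axis i \<i>)) (at 0)"

definition wirt :: "'n::finite \<Rightarrow> (complex ^ 'n \<Rightarrow> complex) \<Rightarrow> complex ^ 'n \<Rightarrow> complex" where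
  "wirt i f z = (1 / 2) * (partial_x i f z - \<i> * partial_y i f z)"

definition wirt_bar :: "'n::finite \<Rightarrow> (complex ^ 'n \<Rightarrow> complex) \<Rightarrow> complex ^ 'n \<Rightarrow> complex" where
  "wirt_bar i f z = (1 / 2) * (partial_x i f z + \<i> * partial_y i f z)"

definition gen_wirt ::
  "(complex ^ 'n \<Rightarrow> complex) \<Rightarrow> 'n::finite \<Rightarrow> (complex ^ 'n \<Rightarrow> complex) \<Rightarrow> complex ^ 'n \<Rightarrow> complex" where
  "gen_wirt K i w z = wirt i w z + w z * wirt i K z"

definition gen_wirt_bar ::
  "(complex ^ 'n \<Rightarrow> complex) \<Rightarrow> 'n::finite \<Rightarrow> (complex ^ 'n \<Rightarrow> complex) \<Rightarrow> complex ^ 'n \<Rightarrow> complex" where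
  "gen_wirt_bar K i w z = wirt_bar i w z + w z * wirt_bar i K z"

definition dz :: "'n::finite \<Rightarrow> 'n cform" where
  "dz i z v = v $ i"

definition dz_bar :: "'n::finite \<Rightarrow> 'n cform" where
  "dz_bar i z v = cnj (v $ i)"

definition del :: "(complex ^ 'n \<Rightarrow> complex) \<Rightarrow> 'n::finite cform" where
  "del f z v = (\<Sum>i\<in>UNIV. wirt i f z * dz i z v)"

definition del_bar :: "(complex ^ 'n \<Rightarrow> complex) \<Rightarrow> 'n::finite cform" where
  "del_bar f z v = (\<Sum>i\<in>UNIV. wirt_bar i f z * dz_bar i z v)"

text \<open>
  The differential \<open>d f\<close> is the total real derivative, so that \<open>d = \<partial> + \<partial>\<close>-bar on
  differentiable functions is a statement to be proved and not a convention.
\<close>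

definition ext_d :: "(complex ^ 'n \<Rightarrow> complex) \<Rightarrow> 'n::finite cform" where
  "ext_d f z = frechet_derivative f (at z)"

definition gen_ext_d :: "(complex ^ 'n \<Rightarrow> complex) \<Rightarrow> (complex ^ 'n \<Rightarrow> complex) \<Rightarrow> 'n::finite cform" where
  "gen_ext_d K w z v =
     (\<Sum>i\<in>UNIV. gen_wirt K i w z * dz i z v) + (\<Sum>i\<in>UNIV. gen_wirt_bar K i w z * dz_bar i z v)"

definition gen_del :: "(complex ^ 'n \<Rightarrow> complex) \<Rightarrow> (complex ^ 'n \<Rightarrow> complex) \<Rightarrow> 'n::finite cform" where
  "gen_del K w z v = del w z v + w z * del K z v"

definition gen_del_bar :: "(complex ^ 'n \<Rightarrow> complex) \<Rightarrow> (complex ^ 'n \<Rightarrow> complex) \<Rightarrow> 'n::finite cform" where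
  "gen_del_bar K w z v = del_bar w z v + w z * del_bar K z v"

end

theory Submission
  imports Defs
begin

text \<open>
  Write \<open>D\<close> for the total real derivative of a function \<open>f\<close> at a point.  As a real vector space,
  \<^typ>\<open>complex ^ 'n\<close> is spanned by the vectors \<open>axis i 1\<close> and \<open>axis i \<i>\<close>, on which \<open>D\<close> takes the
  values \<open>\<partial>f/\<partial>x\<^sup>i\<close> and \<open>\<partial>f/\<partial>y\<^sup>i\<close> by the chain rule.  Real linearity of \<open>D\<close> therefore gives
  \<open>D v = (\<Sum>i. \<partial>f/\<partial>x\<^sup>i Re v\<^sub>i + \<partial>f/\<partial>y\<^sup>i Im v\<^sub>i)\<close>; substituting
  \<open>Re v\<^sub>i = (v\<^sub>i + cnj v\<^sub>i) / 2\<close> and \<open>Im v\<^sub>i = (v\<^sub>i - cnj v\<^sub>i) / (2 \<i>)\<close> regroups each summand into the two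
  Wirtinger terms, which is \<open>d = \<partial> + \<partial>\<close>-bar (\<open>ext_d_eq_del_plus_del_bar\<close>).

  The generalized operator adds to each Wirtinger derivative of \<open>w\<close> the multiple by \<open>w\<close> of the same
  derivative of \<open>K\<close>.  Pulling the factor \<open>w\<close> out of the sums yields the splitting into
  \<open>\<partial>w + w \<partial>K\<close> and its counterpart with \<open>\<partial>\<close>-bar.  The two halves recombine into \<open>dw + w dK\<close> by
  applying \<open>d = \<partial> + \<partial>\<close>-bar both to \<open>w\<close> and to \<open>K\<close>, whose differentiability follows from that of its
  real and imaginary parts.
\<close>

text \<open>
  Both partial derivatives are instances of this chain rule along the line \<open>t \<mapsto> z + t u\<close>.
\<close>

lemma vector_derivative_along_line:
  fixes f :: "'a::real_normed_vector \<Rightarrow> 'b::real_normed_vector"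
  assumes "(f has_derivative D) (at z)"
  shows "vector_derivative (\<lambda>t::real. f (z + t *\<^sub>R u)) (at 0) = D u"
proof (rule vector_derivative_at)
  have line: "((\<lambda>t::real. z + t *\<^sub>R u) has_derivative (\<lambda>t. t *\<^sub>R u)) (at 0)"
    by (auto intro!: derivative_eq_intros)
  have "((\<lambda>t::real. f (z + t *\<^sub>R u)) has_derivative (\<lambda>t. D (t *\<^sub>R u))) (at 0)"
    using has_derivative_compose[OF line, of f D] assms by simp
  moreover have "D (t *\<^sub>R u) = t *\<^sub>R D u" for t
    by (rule linear_scale[OF has_derivative_linear[OF assms]])
  ultimately show "((\<lambda>t::real. f (z + t *\<^sub>R u)) has_vector_derivative D u) (at 0)"
    by (simp add: has_vector_derivative_def)
qed

lemma complex_vector_real_expansion: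
  fixes v :: "complex ^ 'n::finite"
  shows "v = (\<Sum>i\<in>UNIV. Re (v $ i) *\<^sub>R axis i 1 + Im (v $ i) *\<^sub>R axis i \<i>)"
proof -
  have "(\<Sum>i\<in>UNIV. (Re (v $ i) *\<^sub>R axis i 1 + Im (v $ i) *\<^sub>R axis i \<i>) $ j) = v $ j" for j
  proof -
    have "(\<Sum>i\<in>UNIV. (Re (v $ i) *\<^sub>R axis i 1 + Im (v $ i) *\<^sub>R axis i \<i>) $ j)
        = (\<Sum>i\<in>UNIV. if i = j then v $ i else 0)"
      by (intro sum.cong refl) (auto simp: axis_def complex_eq_iff)
    then show ?thesis by simp
  qed
  then show ?thesis by (simp add: vec_eq_iff)
qed

lemma ext_d_eq_del_plus_del_bar:
  assumes "f differentiable (at z)"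
  shows "ext_d f z v = del f z v + del_bar f z v"
proof -
  define D where "D = frechet_derivative f (at z)"
  have D: "(f has_derivative D) (at z)"
    using assms by (simp add: D_def frechet_derivative_works)
  have px: "partial_x i f z = D (axis i 1)" and py: "partial_y i f z = D (axis i \<i>)" for i
    unfolding partial_x_def partial_y_def by (rule vector_derivative_along_line[OF D])+
  have lin: "linear D"
    by (rule has_derivative_linear[OF D])
  \<comment> \<open>the change from real to complex coordinates, with \<open>a\<close> and \<open>b\<close> for the two partial derivatives\<close>
  have wirtinger: "Re c *\<^sub>R a + Im c *\<^sub>R b
      = (1 / 2) * (a - \<i> * b) * c + (1 / 2) * (a + \<i> * b) * cnj c" for a b c :: complex
    by (simp add: complex_eq_iff field_simps)
  have "ext_d f z v = D (\<Sum>i\<in>UNIV. Re (v $ i) *\<^sub>R axis i 1 + Im (v $ i) *\<^sub>R axis i \<i>)"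
    unfolding ext_d_def D_def[symmetric] by (rule arg_cong[OF complex_vector_real_expansion])
  also have "\<dots> = (\<Sum>i\<in>UNIV. Re (v $ i) *\<^sub>R D (axis i 1) + Im (v $ i) *\<^sub>R D (axis i \<i>))"
    by (simp add: linear_sum[OF lin] linear_add[OF lin] linear_scale[OF lin])
  also have "\<dots> = (\<Sum>i\<in>UNIV. wirt i f z * dz i z v + wirt_bar i f z * dz_bar i z v)"
    by (simp only: wirtinger wirt_def wirt_bar_def px py dz_def dz_bar_def)
  also have "\<dots> = del f z v + del_bar f z v"
    by (simp add: del_def del_bar_def sum.distrib)
  finally show ?thesis .
qed

lemma gen_ext_d_eq_gen_del_plus_gen_del_bar:
  "gen_ext_d K w z v = gen_del K w z v + gen_del_bar K w z v"
proof -
  have "(\<Sum>i\<in>UNIV. gen_wirt K i w z * dz i z v) = gen_del K w z v"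
    unfolding gen_del_def gen_wirt_def del_def
    by (simp only: distrib_right sum.distrib sum_distrib_left mult.assoc)
  moreover have "(\<Sum>i\<in>UNIV. gen_wirt_bar K i w z * dz_bar i z v) = gen_del_bar K w z v"
    unfolding gen_del_bar_def gen_wirt_bar_def del_bar_def
    by (simp only: distrib_right sum.distrib sum_distrib_left mult.assoc)
  ultimately show ?thesis
    by (simp only: gen_ext_d_def)
qed

lemma gen_ext_d_eq_ext_d_plus_mult:
  assumes "w differentiable (at z)" and "K differentiable (at z)"
  shows "gen_ext_d K w z v = ext_d w z v + w z * ext_d K z v"
  unfolding gen_ext_d_eq_gen_del_plus_gen_del_bar gen_del_def gen_del_bar_def
    ext_d_eq_del_plus_del_bar[OF assms(1)] ext_d_eq_del_plus_del_bar[OF assms(2)]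
  by (simp add: distrib_left)

theorem theorem5:
  fixes \<Omega> :: "(complex ^ 'n::finite) set"
    and K :: "complex ^ 'n \<Rightarrow> complex"
    and k1 k2 :: "complex ^ 'n \<Rightarrow> real"
  assumes "open \<Omega>"
    and "\<And>z. z \<in> \<Omega> \<Longrightarrow> K z = of_real (k1 z) + \<i> * of_real (k2 z)"
    and "continuous_on \<Omega> k1" and "continuous_on \<Omega> k2"
    and "k1 differentiable_on \<Omega>" and "k2 differentiable_on \<Omega>"
  shows "(\<forall>f. f differentiable_on \<Omega> \<longrightarrow>
            (\<forall>z\<in>\<Omega>. \<forall>v. ext_d f z v = del f z v + del_bar f z v)) \<and>
         (\<forall>w. w differentiable_on \<Omega> \<longrightarrow>
            (\<forall>z\<in>\<Omega>. \<forall>v.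
               gen_ext_d K w z v = ext_d w z v + w z * ext_d K z v \<and>
               gen_ext_d K w z v = gen_del K w z v + gen_del_bar K w z v \<and>
               gen_ext_d K w z v =
                 (del w z v + w z * del K z v) + (del_bar w z v + w z * del_bar K z v)))"
proof -
  have at: "f differentiable (at z)" if "f differentiable_on \<Omega>" "z \<in> \<Omega>"
    for f :: "complex ^ 'n \<Rightarrow> complex" and z
    using that \<open>open \<Omega>\<close> by (simp add: differentiable_on_eq_differentiable_at)
  have K: "K differentiable_on \<Omega>"
    unfolding differentiable_on_def
  proof
    fix z assume z: "z \<in> \<Omega>"
    obtain D1 D2 where "(k1 has_derivative D1) (at z within \<Omega>)"
      and "(k2 has_derivative D2) (at z within \<Omega>)"
      using assms(5,6) z unfolding differentiable_on_def differentiable_def by blast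
    then have "((\<lambda>z. of_real (k1 z) + \<i> * of_real (k2 z) :: complex) has_derivative
        (\<lambda>v. of_real (D1 v) + \<i> * of_real (D2 v))) (at z within \<Omega>)"
      by (intro has_derivative_add has_derivative_mult_right has_derivative_of_real)
    then have "(K has_derivative (\<lambda>v. of_real (D1 v) + \<i> * of_real (D2 v))) (at z within \<Omega>)"
      by (rule has_derivative_transform[OF z, rotated]) (rule assms(2))
    then show "K differentiable (at z within \<Omega>)"
      unfolding differentiable_def by blast
  qed
  have "ext_d f z v = del f z v + del_bar f z v"
    if "f differentiable_on \<Omega>" "z \<in> \<Omega>" for f z v
    by (rule ext_d_eq_del_plus_del_bar[OF at[OF that]])
  moreover have "gen_ext_d K w z v = ext_d w z v + w z * ext_d K z v"
    if "w differentiable_on \<Omega>" "z \<in> \<Omega>" for w z v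
    by (rule gen_ext_d_eq_ext_d_plus_mult[OF at[OF that] at[OF K that(2)]])
  moreover note gen_ext_d_eq_gen_del_plus_gen_del_bar[of K]
  ultimately show ?thesis
    unfolding gen_del_def gen_del_bar_def by blast
qed

end
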